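(* Let $m$ be a pre-measure, and let $R$ be its dual rule. Then, $X\in 2^{\omega}$ is Solovay-$m$-random if and only if it is Solovay-$R$-complex.
   Context: A pre-measure is a recursive function $m$ from finite sets of binary strings to $[0,\infty)$ with $m(\emptyset)=0$, monotone and subadditive; it is extended to arbitrary $A\subseteq 2^{<\omega}$ by $m(A)=\sup\{m(F)\mid F\subseteq A\text{ finite}\}$. A Solovay-$m$-test is an r.e. set $A\subseteq 2^{<\omega}$ with $m(A)<\infty$; $X$ is Solovay-$m$-random if for every Solovay-$m$-test $A$ there is a finite $F\subseteq A$ with $X\notin[A\setminus F]$, where $[B]$ is the open set of reals extending some member of $B$. A rule is a recursive set $R$ of finite subsets of $2^{<\omega}\times\mathbb{Z}$ with $\emptyset\in R$, closed downward under $\prec$ ($s\prec r$ iff every $(\sigma,d)\in s$ has some $(\sigma,d')\in r$ with $d'\le d$), and with $(r\cup s)^{+1}\in R$ whenever $r,s\in R$ ($r^{+i}$ adds $i$ to all second coordinates). $K_R$ denotes an $R$-optimal complexity function: a right r.e. $K:2^{<\omega}\to\omega$ all of whose finite graphs lie in $R$ and which is below (up to an additive constant) every r.e. set of pairs whose finite subsets lie in $R$. $X$ is Solovay-$R$-complex if $\lim_{n\to\infty}(K_R(X\upharpoonright n)-n)=\infty$. With $\mathring{r}$ the set of strings occurring in $r$ and $\|r\|=\min\{|\sigma|-d\mid(\sigma,d)\in r\}$, define $m^{\mathrm{d}}=\{r\mid\forall s\subseteq r\ m(\mathring{s})\le 2^{-\|s\|}\}$ and $R^{\mathrm{d}}(F)=\inf\{\sum_{j\le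 l}2^{-\|r_j\|}\mid r_1,\dots,r_l\in R,\ F\subseteq\bigcup_j\mathring{r_j}\}$. $R$ is a dual rule of $m$ if for some $c$, $K_R-c\le K_{m^{\mathrm{d}}}\le K_R+c$, equivalently $(1/c)m\le R^{\mathrm{d}}\le cm$. *)

theory Defs
  imports Complex_Main "HOL-Library.Nat_Bijection" "HOL-Library.Extended_Nonnegative_Real"
begin

text \<open>
  \<open>recfn n f\<close>: on argument lists of length \<open>n\<close>, \<open>f\<close> is a total general recursive function.
  Minimisation is restricted to regular functions, so exactly the total computable functions arise;
  by \<open>ext\<close>, the values of \<open>f\<close> on lists of other lengths are irrelevant.
\<close>

inductive recfn :: "nat \<Rightarrow> (nat list \<Rightarrow> nat) \<Rightarrow> bool" where
  zero: "recfn n (\<lambda>xs. 0)"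
| succ: "recfn 1 (\<lambda>xs. Suc (hd xs))"
| proj: "i < n \<Longrightarrow> recfn n (\<lambda>xs. xs ! i)"
| comp: "recfn (length gs) f \<Longrightarrow> (\<forall>g\<in>set gs. recfn n g) \<Longrightarrow>
    recfn n (\<lambda>xs. f (map (\<lambda>g. g xs) gs))"
| prim: "recfn n f \<Longrightarrow> recfn (Suc (Suc n)) g \<Longrightarrow>
    recfn (Suc n) (\<lambda>xs. rec_nat (f (tl xs)) (\<lambda>k y. g (k # y # tl xs)) (hd xs))"
| mu: "recfn (Suc n) f \<Longrightarrow> (\<forall>xs. length xs = n \<longrightarrow> (\<exists>k. f (k # xs) = 0)) \<Longrightarrow>
    recfn n (\<lambda>xs. LEAST k. f (k # xs) = 0)"
| ext: "recfn n f \<Longrightarrow> (\<forall>xs. length xs = n \<longrightarrow> f xs = g xs) \<Longrightarrow> recfn n g"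

definition recursive_set :: "nat set \<Rightarrow> bool" where
  "recursive_set S \<longleftrightarrow> recfn 1 (\<lambda>xs. of_bool (hd xs \<in> S))"

definition re_set :: "nat set \<Rightarrow> bool" where
  "re_set S \<longleftrightarrow> S = {} \<or> (\<exists>f. recfn 1 f \<and> S = range (\<lambda>n. f [n]))"

type_synonym bstring = "bool list"
type_synonym cantor = "nat \<Rightarrow> bool"

definition string_code :: "bstring \<Rightarrow> nat" where
  "string_code \<sigma> = list_encode (map of_bool \<sigma>)"

definition pair_code :: "bstring \<times> int \<Rightarrow> nat" where
  "pair_code p = prod_encode (string_code (fst p), int_encode (snd p))"

definition re_strings :: "bstring set \<Rightarrow> bool" where
  "re_strings A \<longleftrightarrow> re_set (string_code ` A)"

definition re_pairs :: "(bstring \<times> int) set \<Rightarrow> bool" where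
  "re_pairs A \<longleftrightarrow> re_set (pair_code ` A)"

text \<open>
  Recursiveness of a nonnegative real-valued function on finite sets of strings, in the sense of
  computable analysis: dyadic approximations of error at most \<open>2\<^sup>-\<^sup>k\<close> are computable from \<open>k\<close> and
  the canonical index of the set.
\<close>

definition recursive_on_finsets :: "(bstring set \<Rightarrow> real) \<Rightarrow> bool" where
  "recursive_on_finsets m \<longleftrightarrow>
    (\<exists>f. recfn 2 f \<and>
      (\<forall>F k. finite F \<longrightarrow>
        \<bar>m F - real (f [set_encode (string_code ` F), k]) / 2 ^ k\<bar> \<le> 1 / 2 ^ k))"

text \<open>Only the values of \<open>m\<close> on finite sets matter.\<close>

definition pre_measure :: "(bstring set \<Rightarrow> real) \<Rightarrow> bool" where
  "pre_measure m \<longleftrightarrow>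
    recursive_on_finsets m \<and>
    (\<forall>F. finite F \<longrightarrow> 0 \<le> m F) \<and>
    m {} = 0 \<and>
    (\<forall>F G. finite G \<longrightarrow> F \<subseteq> G \<longrightarrow> m F \<le> m G) \<and>
    (\<forall>F G. finite F \<longrightarrow> finite G \<longrightarrow> m (F \<union> G) \<le> m F + m G)"

definition pm_ext :: "(bstring set \<Rightarrow> real) \<Rightarrow> bstring set \<Rightarrow> ennreal" where
  "pm_ext m A = (SUP F\<in>{F. finite F \<and> F \<subseteq> A}. ennreal (m F))"

definition restr :: "cantor \<Rightarrow> nat \<Rightarrow> bstring" where
  "restr X n = map X [0..<n]"

definition open_of :: "bstring set \<Rightarrow> cantor set" where
  "open_of B = {X. \<exists>\<sigma>\<in>B. restr X (length \<sigma>) = \<sigma>}"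

definition solovay_test :: "(bstring set \<Rightarrow> real) \<Rightarrow> bstring set \<Rightarrow> bool" where
  "solovay_test m A \<longleftrightarrow> re_strings A \<and> pm_ext m A < \<infinity>"

definition solovay_random :: "(bstring set \<Rightarrow> real) \<Rightarrow> cantor \<Rightarrow> bool" where
  "solovay_random m X \<longleftrightarrow>
    (\<forall>A. solovay_test m A \<longrightarrow> (\<exists>F. finite F \<and> F \<subseteq> A \<and> X \<notin> open_of (A - F)))"

definition below :: "(bstring \<times> int) set \<Rightarrow> (bstring \<times> int) set \<Rightarrow> bool" where
  "below s r \<longleftrightarrow> (\<forall>(\<sigma>, d)\<in>s. \<exists>d'. (\<sigma>, d') \<in> r \<and> d' \<le> d)"

definition shift :: "int \<Rightarrow> (bstring \<times> int) set \<Rightarrow> (bstring \<times> int) set" where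
  "shift i r = (\<lambda>(\<sigma>, d). (\<sigma>, d + i)) ` r"

definition is_rule :: "(bstring \<times> int) set set \<Rightarrow> bool" where
  "is_rule R \<longleftrightarrow>
    (\<forall>r\<in>R. finite r) \<and>
    recursive_set ((\<lambda>r. set_encode (pair_code ` r)) ` R) \<and>
    {} \<in> R \<and>
    (\<forall>r\<in>R. \<forall>s. finite s \<longrightarrow> below s r \<longrightarrow> s \<in> R) \<and>
    (\<forall>r\<in>R. \<forall>s\<in>R. shift 1 (r \<union> s) \<in> R)"

definition right_re :: "(bstring \<Rightarrow> nat) \<Rightarrow> bool" where
  "right_re K \<longleftrightarrow> re_pairs {(\<sigma>, d). int (K \<sigma>) \<le> d}"

text \<open>
  \<open>R\<close> is not required to be a rule here: the notion is also applied to \<open>dual_set m\<close> below, which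
  need not be recursive for a real-valued \<open>m\<close>.
\<close>

definition complexity_fn :: "(bstring \<times> int) set set \<Rightarrow> (bstring \<Rightarrow> nat) \<Rightarrow> bool" where
  "complexity_fn R K \<longleftrightarrow>
    right_re K \<and> (\<forall>F. finite F \<longrightarrow> (\<lambda>\<sigma>. (\<sigma>, int (K \<sigma>))) ` F \<in> R)"

definition optimal_complexity :: "(bstring \<times> int) set set \<Rightarrow> (bstring \<Rightarrow> nat) \<Rightarrow> bool" where
  "optimal_complexity R K \<longleftrightarrow>
    complexity_fn R K \<and>
    (\<forall>A. re_pairs A \<longrightarrow> (\<forall>r. finite r \<longrightarrow> r \<subseteq> A \<longrightarrow> r \<in> R) \<longrightarrow>
      (\<exists>c. \<forall>(\<sigma>, d)\<in>A. int (K \<sigma>) \<le> d + c))"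

text \<open>
  For a set closed downward under \<open>below\<close> (a rule, or \<open>dual_set m\<close>), optimal complexity functions
  differ by at most an additive constant, so the choice of \<open>K\<close> is immaterial in the next definition
  and in \<open>dual_rule\<close>.
\<close>

definition solovay_complex :: "(bstring \<times> int) set set \<Rightarrow> cantor \<Rightarrow> bool" where
  "solovay_complex R X \<longleftrightarrow>
    (\<exists>K. optimal_complexity R K \<and>
      filterlim (\<lambda>n. int (K (restr X n)) - int n) at_top sequentially)"

definition pnorm :: "(bstring \<times> int) set \<Rightarrow> int" where
  "pnorm r = Min ((\<lambda>(\<sigma>, d). int (length \<sigma>) - d) ` r)"

text \<open>
  The empty \<open>s\<close> is left out because the minimum over it is \<open>\<infinity>\<close>; its condition then
  reads \<open>m {} \<le> 0\<close>, which holds for every pre-measure.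
\<close>

definition dual_set :: "(bstring set \<Rightarrow> real) \<Rightarrow> (bstring \<times> int) set set" where
  "dual_set m = {r. finite r \<and>
    (\<forall>s. s \<subseteq> r \<longrightarrow> s \<noteq> {} \<longrightarrow> m (fst ` s) \<le> 2 powi (- pnorm s))}"

definition dual_rule :: "(bstring set \<Rightarrow> real) \<Rightarrow> (bstring \<times> int) set set \<Rightarrow> bool" where
  "dual_rule m R \<longleftrightarrow>
    is_rule R \<and>
    (\<exists>K K' c. optimal_complexity R K \<and> optimal_complexity (dual_set m) K' \<and>
      (\<forall>\<sigma>. int (K \<sigma>) - c \<le> int (K' \<sigma>) \<and> int (K' \<sigma>) \<le> int (K \<sigma>) + c))"

end

theory Submission
  imports Defs
begin

text \<open>
  Let \<open>K\<close> be optimal for the dual set of \<open>m\<close>; up to an additive constant it agrees with every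
  optimal complexity function of \<open>R\<close>. If \<open>A\<close> is a Solovay test with \<open>m(A) \<le> 2\<^sup>c\<close>, then all finite
  subsets of \<open>{(\<sigma>, |\<sigma>| + c) | \<sigma> \<in> A}\<close> lie in the dual set, so \<open>K(\<sigma>) - |\<sigma>|\<close> is bounded on \<open>A\<close>.
  Conversely, membership of the graph of \<open>K\<close> in the dual set bounds \<open>m\<close> by \<open>2\<^sup>c\<close> on the finite
  subsets of \<open>{\<sigma> | K(\<sigma>) \<le> |\<sigma>| + c}\<close>, which is therefore a Solovay test.
\<close>

section \<open>Recursive functions on codes\<close>

text \<open>Curried forms of \<open>recfn\<close>. Arguments are read off with \<open>!\<close>, so
  that \<open>recfn.proj\<close> applies directly once the definition is unfolded.\<close>

definition recfn1 :: "(nat \<Rightarrow> nat) \<Rightarrow> bool" where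
  "recfn1 f \<longleftrightarrow> recfn 1 (\<lambda>xs. f (xs ! 0))"

definition recfn2 :: "(nat \<Rightarrow> nat \<Rightarrow> nat) \<Rightarrow> bool" where
  "recfn2 f \<longleftrightarrow> recfn 2 (\<lambda>xs. f (xs ! 0) (xs ! 1))"

lemma recfn_comp1:
  assumes "recfn1 f" "recfn n a"
  shows "recfn n (\<lambda>xs. f (a xs))"
  using recfn.comp[of "[a]" "\<lambda>xs. f (xs ! 0)" n] assms by (simp add: recfn1_def)

lemma recfn_comp2:
  assumes "recfn2 f" "recfn n a" "recfn n b"
  shows "recfn n (\<lambda>xs. f (a xs) (b xs))"
  using recfn.comp[of "[a, b]" "\<lambda>xs. f (xs ! 0) (xs ! 1)" n] assms
  by (simp add: recfn2_def numeral_2_eq_2)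

lemma recfn1_Suc: "recfn1 Suc"
  unfolding recfn1_def by (rule recfn.ext[OF recfn.succ]) (simp add: hd_conv_nth flip: length_greater_0_conv)

lemma recfn_const: "recfn n (\<lambda>xs. k)"
  by (induction k) (auto intro: recfn.zero recfn_comp1[OF recfn1_Suc])

lemma recfn1_rec_nat:
  assumes "recfn2 g"
  shows "recfn1 (rec_nat a g)"
  unfolding recfn1_def
proof (rule recfn.ext)
  show "recfn 1 (\<lambda>xs. rec_nat a (\<lambda>k y. g ((k # y # tl xs) ! 0) ((k # y # tl xs) ! 1)) (hd xs))"
    using recfn.prim[OF recfn_const[of 0 a], of "\<lambda>xs. g (xs ! 0) (xs ! 1)"] assms
    by (simp add: recfn2_def numeral_2_eq_2)
qed (auto simp: length_Suc_conv)

lemma recfn2_rec_nat: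
  assumes "recfn1 f" "recfn2 g"
  shows "recfn2 (\<lambda>k x. rec_nat (f x) g k)"
  unfolding recfn2_def
proof (rule recfn.ext)
  \<comment> \<open>\<open>recfn.prim\<close> also hands the parameter to the step function, so
    \<open>g\<close> is padded with an ignored third argument.\<close>
  have "recfn (Suc (Suc 1)) (\<lambda>xs. g (xs ! 0) (xs ! 1))"
    by (intro recfn_comp2[OF assms(2)] recfn.proj) auto
  from recfn.prim[OF assms(1)[unfolded recfn1_def] this]
  show "recfn 2 (\<lambda>xs. rec_nat (f (tl xs ! 0))
      (\<lambda>k y. g ((k # y # tl xs) ! 0) ((k # y # tl xs) ! 1)) (hd xs))"
    by (simp add: numeral_2_eq_2)
qed (auto simp: length_Suc_conv numeral_2_eq_2)

lemma recfn1_Least: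
  assumes "recfn2 f" "\<And>x. \<exists>k. f k x = 0"
  shows "recfn1 (\<lambda>x. LEAST k. f k x = 0)"
  unfolding recfn1_def
proof (rule recfn.ext)
  show "recfn 1 (\<lambda>xs. LEAST k. f ((k # xs) ! 0) ((k # xs) ! 1) = 0)"
    using recfn.mu[of 1 "\<lambda>xs. f (xs ! 0) (xs ! 1)"] assms
    by (auto simp: recfn2_def numeral_2_eq_2)
qed simp

section \<open>Arithmetic and case distinction\<close>

lemma recfn1_id: "recfn1 (\<lambda>x. x)"
  unfolding recfn1_def by (rule recfn.proj) simp

lemma recfn2_add: "recfn2 (+)"
proof -
  have "recfn2 (\<lambda>k. Suc)"
    unfolding recfn2_def by (intro recfn_comp1[OF recfn1_Suc] recfn.proj) simp
  moreover have "rec_nat x (\<lambda>k. Suc) k = k + x" for k x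
    by (induction k) auto
  ultimately show ?thesis
    using recfn2_rec_nat[OF recfn1_id, of "\<lambda>k. Suc"] by simp
qed

text \<open>Primitive recursion whose step returns the counter and forgets the previous
  value.\<close>

lemma recfn1_pred: "recfn1 (\<lambda>x. x - 1)"
proof -
  have "recfn2 (\<lambda>k y. k)"
    unfolding recfn2_def by (rule recfn.proj) simp
  moreover have "rec_nat 0 (\<lambda>k y. k) x = x - 1" for x
    by (cases x) auto
  ultimately show ?thesis
    using recfn1_rec_nat[of "\<lambda>k y. k" 0] by presburger
qed

lemma recfn2_diff: "recfn2 (\<lambda>x y. x - y)"
proof -
  have "recfn2 (\<lambda>k y. y - 1)"
    unfolding recfn2_def by (intro recfn_comp1[OF recfn1_pred] recfn.proj) simp
  moreover have "rec_nat x (\<lambda>k y. y - 1) k = x - k" for k x :: nat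
    by (induction k) auto
  \<comment> \<open>The recursion runs on the subtrahend, so the arguments come out swapped;
    projections restore their order.\<close>
  ultimately have *: "recfn2 (\<lambda>k x. x - k)"
    using recfn2_rec_nat[OF recfn1_id, of "\<lambda>k y. y - 1"] by simp
  show ?thesis
    unfolding recfn2_def by (intro recfn_comp2[OF *] recfn.proj) auto
qed

text \<open>Two numbers are equal iff both truncated differences vanish. Recursion on the sum of the
  differences then selects the branch.\<close>

lemma recfn_If_eq:
  assumes "recfn n a" "recfn n b" "recfn n c" "recfn n d"
  shows "recfn n (\<lambda>xs. if a xs = b xs then c xs else d xs)"
proof -
  have *: "recfn n (\<lambda>xs. (a xs - b xs) + (b xs - a xs))"
    by (intro recfn_comp2[OF recfn2_add] recfn_comp2[OF recfn2_diff] assms)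
  \<comment> \<open>On \<open>[t, c, d]\<close> the start value is \<open>c\<close>, and every step
    returns entry 3 of \<open>[k, y, c, d]\<close>, which is \<open>d\<close>.\<close>
  have "recfn 3 (\<lambda>xs. rec_nat (tl xs ! 0) (\<lambda>k y. (k # y # tl xs) ! 3) (hd xs))" (is "recfn 3 ?cond")
    using recfn.prim[of 2 "\<lambda>xs. xs ! 0" "\<lambda>xs. xs ! 3"]
    by (simp add: recfn.proj numeral_2_eq_2 numeral_3_eq_3)
  then have "recfn n (\<lambda>xs. ?cond (map (\<lambda>g. g xs)
      [\<lambda>xs. (a xs - b xs) + (b xs - a xs), c, d]))"
    using * assms by (intro recfn.comp) (simp_all add: numeral_3_eq_3)
  moreover have "rec_nat x (\<lambda>k y. z) i = (if i = 0 then x else z)" for x z i :: nat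
    by (cases i) auto
  ultimately show ?thesis
    by (elim recfn.ext) (auto simp: numeral_3_eq_3)
qed

section \<open>Pairing function and list codes\<close>

lemma recfn1_triangle: "recfn1 triangle"
proof -
  have "recfn2 (\<lambda>k y. y + Suc k)"
    unfolding recfn2_def
    by (intro recfn_comp2[OF recfn2_add] recfn_comp1[OF recfn1_Suc] recfn.proj) auto
  moreover have "rec_nat 0 (\<lambda>k y. y + Suc k) x = triangle x" for x
    by (induction x) auto
  ultimately show ?thesis
    using recfn1_rec_nat[of "\<lambda>k y. y + Suc k" 0] by presburger
qed

lemma recfn2_prod_encode: "recfn2 (\<lambda>x y. prod_encode (x, y))"
  unfolding recfn2_def prod_encode_def prod.case
  by (intro recfn_comp2[OF recfn2_add] recfn_comp1[OF recfn1_triangle] recfn.proj) auto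

text \<open>The code of \<open>(a, b)\<close> is \<open>triangle (a + b) + a\<close>, which lies
  below \<open>triangle (Suc (a + b))\<close>. The truncated difference is zero exactly when the
  code is less than \<open>triangle (Suc s)\<close>, so minimisation finds the diagonal.\<close>

lemma Least_triangle: "(LEAST s. Suc (prod_encode (a, b)) - triangle (Suc s) = 0) = a + b"
proof (rule Least_equality)
  show "Suc (prod_encode (a, b)) - triangle (Suc (a + b)) = 0"
    by (simp add: prod_encode_def)
next
  fix s assume s: "Suc (prod_encode (a, b)) - triangle (Suc s) = 0"
  have mono: "mono triangle"
    by (rule incseq_SucI) simp
  show "a + b \<le> s"
  proof (rule ccontr)
    assume "\<not> a + b \<le> s"
    then have "triangle (Suc s) \<le> triangle (a + b)"
      by (intro monoD[OF mono]) auto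
    with s show False
      by (simp add: prod_encode_def del: triangle_Suc)
  qed
qed

text \<open>Once the diagonal \<open>s\<close> is found by minimisation, the first component is
  \<open>x - triangle (s x)\<close> and the second is what remains of \<open>s x\<close>.\<close>

lemma recfn1_prod_decode:
  shows recfn1_fst_prod_decode: "recfn1 (\<lambda>x. fst (prod_decode x))"
    and recfn1_snd_prod_decode: "recfn1 (\<lambda>x. snd (prod_decode x))"
proof -
  define s where "s x = (LEAST s. Suc x - triangle (Suc s) = 0)" for x
  have s: "s x = fst (prod_decode x) + snd (prod_decode x)" for x
    using Least_triangle[of "fst (prod_decode x)" "snd (prod_decode x)"] by (simp add: s_def)
  have "recfn2 (\<lambda>s x. Suc x - triangle (Suc s))"
    unfolding recfn2_def
    by (intro recfn_comp2[OF recfn2_diff] recfn_comp1[OF recfn1_triangle]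
        recfn_comp1[OF recfn1_Suc] recfn.proj) auto
  \<comment> \<open>The witness \<open>x\<close> works because \<open>triangle (Suc x)\<close> is
    \<open>triangle x + Suc x\<close>.\<close>
  moreover have "\<exists>s. Suc x - triangle (Suc s) = 0" for x
    by (intro exI[of _ x]) simp
  ultimately have rs: "recfn1 s"
    unfolding s_def by (rule recfn1_Least)
  have "x - triangle (s x) = fst (prod_decode x)" for x
    unfolding s using prod_decode_inverse[of x] by (simp add: prod_encode_def split: prod.splits)
  moreover have "recfn1 (\<lambda>x. x - triangle (s x))"
    unfolding recfn1_def
    by (intro recfn_comp2[OF recfn2_diff] recfn_comp1[OF recfn1_triangle]
        recfn_comp1[OF rs] recfn.proj) auto
  ultimately show fst: "recfn1 (\<lambda>x. fst (prod_decode x))"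
    by simp
  have "recfn1 (\<lambda>x. s x - fst (prod_decode x))"
    unfolding recfn1_def
    by (intro recfn_comp2[OF recfn2_diff] recfn_comp1[OF fst] recfn_comp1[OF rs] recfn.proj) auto
  then show "recfn1 (\<lambda>x. snd (prod_decode x))"
    by (simp add: s)
qed

text \<open>The tail operation on codes is iterated; as only the empty list has code 0, the length
  is the least number of iterations that reach 0.\<close>

lemma recfn1_length_list_decode: "recfn1 (\<lambda>x. length (list_decode x))"
proof -
  define t where "t y = snd (prod_decode (y - 1))" for y
  have "recfn2 (\<lambda>k y. t y)"
    unfolding t_def recfn2_def
    by (intro recfn_comp1[OF recfn1_snd_prod_decode] recfn_comp1[OF recfn1_pred] recfn.proj) auto
  then have "recfn2 (\<lambda>k x. rec_nat x (\<lambda>k. t) k)"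
    by (rule recfn2_rec_nat[OF recfn1_id])
  moreover have t: "rec_nat x (\<lambda>k. t) k = list_encode (drop k (list_decode x))" for k x
  proof (induction k)
    case (Suc k)
    \<comment> \<open>Needed for the empty list: \<open>t\<close> must send its code 0 to 0,
      matching \<open>tl [] = []\<close>.\<close>
    moreover have "prod_decode 0 = (0, 0)"
      using prod_encode_inverse[of "(0, 0)"] by (simp add: prod_encode_def)
    then have "t (list_encode xs) = list_encode (tl xs)" for xs
      by (cases xs) (simp_all add: t_def)
    ultimately show ?case
      by (simp add: drop_Suc tl_drop)
  qed simp
  moreover have zero: "list_encode xs = 0 \<longleftrightarrow> xs = []" for xs
    by (cases xs) auto
  moreover have "(LEAST k. length (xs :: nat list) \<le> k) = length xs" for xs
    by (rule Least_equality) auto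
  moreover have "\<exists>k. list_encode (drop k (list_decode x)) = 0" for x
    using zero by auto
  ultimately show ?thesis
    using recfn1_Least[of "\<lambda>k x. rec_nat x (\<lambda>k. t) k"] by simp
qed

section \<open>Recursively enumerable sets of strings and pairs\<close>

lemma re_set_iff: "re_set S \<longleftrightarrow> S = {} \<or> (\<exists>f. recfn1 f \<and> S = range f)"
proof -
  have "(\<exists>f. recfn 1 f \<and> S = range (\<lambda>n. f [n])) \<longleftrightarrow> (\<exists>f. recfn1 f \<and> S = range f)"
  proof
    assume "\<exists>f. recfn 1 f \<and> S = range (\<lambda>n. f [n])"
    then obtain f where f: "recfn 1 f" "S = range (\<lambda>n. f [n])" by blast
    have "recfn1 (\<lambda>n. f [n])"
      unfolding recfn1_def by (rule recfn.ext[OF f(1)]) (auto simp: length_Suc_conv)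
    with f show "\<exists>f. recfn1 f \<and> S = range f" by blast
  next
    assume "\<exists>f. recfn1 f \<and> S = range f"
    then obtain f where "recfn1 f" "S = range f" by blast
    then show "\<exists>f. recfn 1 f \<and> S = range (\<lambda>n. f [n])"
      unfolding recfn1_def by (intro exI[of _ "\<lambda>xs. f (xs ! 0)"]) simp
  qed
  then show ?thesis by (simp add: re_set_def)
qed

lemma re_set_image:
  assumes "re_set S" "recfn1 g"
  shows "re_set (g ` S)"
proof (cases "S = {}")
  case False
  then obtain f where "recfn1 f" "S = range f"
    using assms(1) by (auto simp: re_set_iff)
  moreover from this have "recfn1 (\<lambda>x. g (f x))"
    unfolding recfn1_def using recfn_comp1[OF assms(2)] by (simp add: recfn1_def)
  moreover have "g ` range f = range (\<lambda>x. g (f x))"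
    by auto
  ultimately show ?thesis
    unfolding re_set_iff by blast
qed (simp add: re_set_def)

text \<open>An enumeration has to be total, so elements failing the test are replaced by a fixed
  \<open>y\<close> that passes it. No such \<open>y\<close> exists when the result is empty, hence
  the case split.\<close>

lemma re_set_Collect_eq:
  assumes "re_set S" "recfn1 a" "recfn1 b"
  shows "re_set {x \<in> S. a x = b x}"
proof (cases "{x \<in> S. a x = b x} = {}")
  case True
  show ?thesis
    unfolding True by (simp add: re_set_def)
next
  case False
  then obtain y where y: "y \<in> S" "a y = b y" by blast
  have "recfn1 (\<lambda>x. if a x = b x then x else y)"
    unfolding recfn1_def
    by (intro recfn_If_eq recfn_comp1[OF assms(2)] recfn_comp1[OF assms(3)] recfn.proj recfn_const)
      auto
  from re_set_image[OF assms(1) this]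
  show ?thesis
  proof (rule back_subst[of re_set])
    show "(\<lambda>x. if a x = b x then x else y) ` S = {x \<in> S. a x = b x}"
      using y by auto
  qed
qed

section \<open>Passing between strings and weighted strings\<close>

lemma list_decode_string_code: "list_decode (string_code \<sigma>) = map of_bool \<sigma>"
  by (simp add: string_code_def)

lemma pair_code_nat: "pair_code (\<sigma>, int k) = prod_encode (string_code \<sigma>, k + k)"
  by (simp add: pair_code_def int_encode_def sum_encode_def)

lemma recfn1_double_length: "recfn1 (\<lambda>x. (length (list_decode x) + c) + (length (list_decode x) + c))"
  unfolding recfn1_def
  by (intro recfn_comp2[OF recfn2_add] recfn_comp1[OF recfn1_length_list_decode] recfn.proj
      recfn_const) auto

text \<open>Turns a Solovay test into a candidate for optimality. A string is as long as its decoded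
  list, so the weight is computable from the string code.\<close>

lemma re_pairs_length_add:
  assumes "re_strings A"
  shows "re_pairs ((\<lambda>\<sigma>. (\<sigma>, int (length \<sigma> + c))) ` A)"
proof -
  define g where "g x = prod_encode (x,
    (length (list_decode x) + c) + (length (list_decode x) + c))" for x
  have "recfn1 g"
    unfolding g_def recfn1_def
    by (intro recfn_comp2[OF recfn2_prod_encode] recfn_comp1[OF recfn1_double_length] recfn.proj)
      auto
  then have "re_set (g ` string_code ` A)"
    using assms by (intro re_set_image) (simp_all add: re_strings_def)
  moreover have "g (string_code \<sigma>) = pair_code (\<sigma>, int (length \<sigma> + c))" for \<sigma>
    by (simp only: pair_code_nat g_def list_decode_string_code length_map)
  ultimately show ?thesis
    by (simp add: re_pairs_def image_image)
qed

text \<open>On codes: keep the pairs whose second component encodes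
  \<open>length \<sigma> + c\<close>, then project to the first. For the upper graph of
  \<open>K\<close> this enumerates a sublevel set of
  \<open>K \<sigma> - length \<sigma>\<close>.\<close>

lemma re_strings_length_add:
  assumes "re_pairs P"
  shows "re_strings {\<sigma>. (\<sigma>, int (length \<sigma> + c)) \<in> P}"
proof -
  define g where "g x =
    (length (list_decode (fst (prod_decode x))) + c) +
    (length (list_decode (fst (prod_decode x))) + c)" for x
  have "recfn1 g"
    unfolding g_def recfn1_def
    by (intro recfn_comp1[OF recfn1_double_length] recfn_comp1[OF recfn1_fst_prod_decode]
        recfn.proj) auto
  then have "re_set ((\<lambda>x. fst (prod_decode x)) `
      {x \<in> pair_code ` P. snd (prod_decode x) = g x})"
    using assms by (intro re_set_image re_set_Collect_eq recfn1_prod_decode) (simp_all add: re_pairs_def)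
  moreover have "(\<lambda>x. fst (prod_decode x)) ` {x \<in> pair_code ` P. snd (prod_decode x) = g x} =
      string_code ` {\<sigma>. (\<sigma>, int (length \<sigma> + c)) \<in> P}" (is "?L = ?R")
  proof -
    have iff: "snd (prod_decode (pair_code (\<sigma>, d))) = g (pair_code (\<sigma>, d)) \<longleftrightarrow>
        d = int (length \<sigma> + c)" for \<sigma> d
    proof -
      have "g (pair_code (\<sigma>, d)) = int_encode (int (length \<sigma> + c))"
        by (simp add: g_def pair_code_def list_decode_string_code int_encode_def sum_encode_def)
      then show ?thesis
        by (simp add: pair_code_def inj_int_encode inj_eq del: of_nat_add)
    qed
    have fst: "fst (prod_decode (pair_code (\<sigma>, d))) = string_code \<sigma>" for \<sigma> d
      by (simp add: pair_code_def)
    have "?L = (\<lambda>p. fst (prod_decode (pair_code p))) `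
        {p \<in> P. snd (prod_decode (pair_code p)) = g (pair_code p)}"
      by auto
    also have "\<dots> = (\<lambda>p. string_code (fst p)) ` {p \<in> P. snd p = int (length (fst p) + c)}"
      using iff fst by (intro image_cong) auto
    also have "\<dots> = ?R"
      by force
    finally show ?thesis .
  qed
  ultimately show ?thesis
    by (simp add: re_strings_def)
qed

section \<open>Complexity functions and Solovay tests\<close>

text \<open>The upper graph of \<open>K\<close> competes with \<open>L\<close>: any finite part of
  it is below the graph of \<open>K\<close> on the same strings, hence in \<open>R\<close> by
  downward closure.\<close>

lemma optimal_complexity_le:
  assumes "is_rule R" "complexity_fn R K" "optimal_complexity R L"
  shows "\<exists>c. \<forall>\<sigma>. int (L \<sigma>) \<le> int (K \<sigma>) + c"
proof -
  let ?A = "{(\<sigma>, d). int (K \<sigma>) \<le> d}"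
  have "r \<in> R" if r: "finite r" "r \<subseteq> ?A" for r
  proof -
    have "(\<lambda>\<sigma>. (\<sigma>, int (K \<sigma>))) ` fst ` r \<in> R"
      using assms(2) r by (simp add: complexity_fn_def)
    moreover have "below r ((\<lambda>\<sigma>. (\<sigma>, int (K \<sigma>))) ` fst ` r)"
      using r by (force simp: below_def)
    ultimately show ?thesis
      using assms(1) r unfolding is_rule_def by blast
  qed
  moreover have "re_pairs ?A"
    using assms(2) by (simp add: complexity_fn_def right_re_def)
  ultimately obtain c where "\<forall>(\<sigma>, d)\<in>?A. int (L \<sigma>) \<le> d + c"
    using assms(3) unfolding optimal_complexity_def by meson
  then show ?thesis
    by (intro exI[of _ c]) auto
qed

text \<open>Replaces \<open>R\<close> by the dual set of \<open>m\<close>, for one fixed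
  \<open>K\<close>. Divergence to infinity is unaffected by bounded changes of the complexity
  function.\<close>

lemma solovay_complex_dual:
  assumes "dual_rule m R"
  obtains K where "optimal_complexity (dual_set m) K"
    and "\<And>X. solovay_complex R X \<longleftrightarrow>
      filterlim (\<lambda>n. int (K (restr X n)) - int n) at_top sequentially"
proof -
  from assms obtain L K c where R: "is_rule R" and L: "optimal_complexity R L"
    and K: "optimal_complexity (dual_set m) K"
    and c: "\<And>\<sigma>. int (L \<sigma>) - c \<le> int (K \<sigma>)" "\<And>\<sigma>. int (K \<sigma>) \<le> int (L \<sigma>) + c"
    unfolding dual_rule_def by blast
  have mono: "filterlim (\<lambda>n. int (V (restr X n)) - int n) at_top sequentially"
    if U: "filterlim (\<lambda>n. int (U (restr X n)) - int n) at_top sequentially"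
      and le: "\<And>\<sigma>. int (U \<sigma>) \<le> int (V \<sigma>) + e" for U V e X
    unfolding filterlim_at_top
  proof
    fix Z
    have "\<forall>\<^sub>F n in sequentially. Z + e \<le> int (U (restr X n)) - int n"
      using U by (simp add: filterlim_at_top)
    then show "\<forall>\<^sub>F n in sequentially. Z \<le> int (V (restr X n)) - int n"
    proof eventually_elim
      case (elim n)
      then show ?case using le[of "restr X n"] by linarith
    qed
  qed
  have "solovay_complex R X \<longleftrightarrow>
      filterlim (\<lambda>n. int (K (restr X n)) - int n) at_top sequentially" for X
  proof
    assume "solovay_complex R X"
    then obtain U where U: "optimal_complexity R U"
      "filterlim (\<lambda>n. int (U (restr X n)) - int n) at_top sequentially"
      unfolding solovay_complex_def by blast
    \<comment> \<open>The function \<open>U\<close> witnessing complexity may differ from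
      \<open>L\<close>; optimality of \<open>U\<close> bounds it by \<open>L\<close>, which in turn
      is at most \<open>K + c\<close>.\<close>
    obtain e where e: "\<And>\<sigma>. int (U \<sigma>) \<le> int (L \<sigma>) + e"
      using optimal_complexity_le[OF R _ U(1)] L unfolding optimal_complexity_def by blast
    have "int (U \<sigma>) \<le> int (K \<sigma>) + (e + c)" for \<sigma>
      using e[of \<sigma>] c(1)[of \<sigma>] by linarith
    with U(2) show "filterlim (\<lambda>n. int (K (restr X n)) - int n) at_top sequentially"
      by (rule mono)
  next
    assume "filterlim (\<lambda>n. int (K (restr X n)) - int n) at_top sequentially"
    then have "filterlim (\<lambda>n. int (L (restr X n)) - int n) at_top sequentially"
      using c(2) by (rule mono)
    with L show "solovay_complex R X"
      unfolding solovay_complex_def by blast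
  qed
  with K show thesis by (rule that)
qed

section \<open>Solovay tests and the dual set\<close>

lemma length_restr [simp]: "length (restr X n) = n"
  by (simp add: restr_def)

text \<open>The smallest exceptional set \<open>F\<close> consists of the initial segments of
  \<open>X\<close> in \<open>A\<close>, and distinct \<open>n\<close> give segments of distinct
  lengths.\<close>

lemma solovay_random_iff_finite:
  "solovay_random m X \<longleftrightarrow> (\<forall>A. solovay_test m A \<longrightarrow> finite {n. restr X n \<in> A})"
proof -
  have "(\<exists>F. finite F \<and> F \<subseteq> A \<and> X \<notin> open_of (A - F)) \<longleftrightarrow> finite {n. restr X n \<in> A}" for A
  proof
    assume "\<exists>F. finite F \<and> F \<subseteq> A \<and> X \<notin> open_of (A - F)"
    then obtain F where F: "finite F" "X \<notin> open_of (A - F)" by blast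
    have "{n. restr X n \<in> A} \<subseteq> length ` F"
    proof
      fix n assume "n \<in> {n. restr X n \<in> A}"
      with F(2) have "restr X n \<in> F"
        by (force simp: open_of_def)
      then show "n \<in> length ` F"
        by (metis imageI length_restr)
    qed
    with F(1) show "finite {n. restr X n \<in> A}"
      by (meson finite_imageI finite_subset)
  next
    assume "finite {n. restr X n \<in> A}"
    moreover have "X \<notin> open_of (A - restr X ` {n. restr X n \<in> A})"
      by (auto simp: open_of_def image_iff) metis
    ultimately show "\<exists>F. finite F \<and> F \<subseteq> A \<and> X \<notin> open_of (A - F)"
      by (intro exI[of _ "restr X ` {n. restr X n \<in> A}"]) auto
  qed
  then show ?thesis
    by (simp add: solovay_random_def)
qed

text \<open>The bound is taken as a power of two because its exponent becomes the weight offset in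
  the dual set.\<close>

lemma solovay_test_bounded:
  assumes "solovay_test m A"
  obtains c :: nat where "\<And>F. finite F \<Longrightarrow> F \<subseteq> A \<Longrightarrow> m F \<le> 2 ^ c"
proof -
  have fin: "pm_ext m A < \<infinity>"
    using assms by (simp add: solovay_test_def)
  obtain c :: nat where c: "enn2real (pm_ext m A) < 2 ^ c"
    using real_arch_pow[of 2] by auto
  have "m F \<le> 2 ^ c" if F: "finite F" "F \<subseteq> A" for F
  proof -
    have "ennreal (m F) \<le> pm_ext m A"
      unfolding pm_ext_def using F by (intro SUP_upper) simp
    also have "\<dots> = ennreal (enn2real (pm_ext m A))"
      using fin by simp
    finally have "m F \<le> enn2real (pm_ext m A)"
      by (simp only: ennreal_le_iff[OF enn2real_nonneg])
    with c show ?thesis by linarith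
  qed
  then show thesis by (rule that)
qed

lemma powi_minus_neg_int: "2 powi (- (- int c)) = (2 :: real) ^ c"
  by (simp add: power_int_def)

lemma solovay_test_imp_dual_set:
  assumes bound: "\<And>F. finite F \<Longrightarrow> F \<subseteq> A \<Longrightarrow> m F \<le> 2 ^ c"
    and r: "finite r" "r \<subseteq> (\<lambda>\<sigma>. (\<sigma>, int (length \<sigma> + c))) ` A"
  shows "r \<in> dual_set m"
proof -
  have "m (fst ` s) \<le> 2 powi (- pnorm s)" if s: "s \<subseteq> r" "s \<noteq> {}" for s
  proof -
    have "(\<lambda>(\<sigma>, d). int (length \<sigma>) - d) p = - int c" if "p \<in> s" for p
      using that s r by auto
    then have "(\<lambda>(\<sigma>, d). int (length \<sigma>) - d) ` s = {- int c}"
      using s(2) by (auto simp: image_iff)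
    then have "pnorm s = - int c"
      by (simp add: pnorm_def)
    moreover have "m (fst ` s) \<le> 2 ^ c"
      using s r by (intro bound) (auto intro: finite_subset)
    ultimately show ?thesis
      by (simp only: powi_minus_neg_int)
  qed
  with r(1) show ?thesis
    by (simp add: dual_set_def)
qed

lemma complexity_fn_dual_set_solovay_test:
  assumes "m {} = 0" "complexity_fn (dual_set m) K"
  shows "solovay_test m {\<sigma>. int (K \<sigma>) \<le> int (length \<sigma> + c)}" (is "solovay_test m ?A")
proof -
  have "re_strings ?A"
    using re_strings_length_add[of "{(\<sigma>, d). int (K \<sigma>) \<le> d}" c] assms(2)
    by (simp add: complexity_fn_def right_re_def)
  moreover have "m F \<le> 2 ^ c" if F: "finite F" "F \<subseteq> ?A" for F
  \<comment> \<open>The dual set constrains nonempty sets of pairs only; for empty \<open>F\<close>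
    the bound comes from \<open>m {} = 0\<close>.\<close>
  proof (cases "F = {}")
    case False
    let ?r = "(\<lambda>\<sigma>. (\<sigma>, int (K \<sigma>))) ` F"
    have "?r \<in> dual_set m"
      using assms(2) F by (simp add: complexity_fn_def)
    then have "m (fst ` ?r) \<le> 2 powi (- pnorm ?r)"
      using False by (simp add: dual_set_def)
    moreover have "fst ` ?r = F"
      by force
    \<comment> \<open>On \<open>F\<close> the complexity exceeds the length by at most
      \<open>c\<close>, so every term of the minimum is at least \<open>- int c\<close>.\<close>
    moreover have "- int c \<le> pnorm ?r"
      unfolding pnorm_def using F False by (subst Min_ge_iff) auto
    then have "(2 :: real) powi (- pnorm ?r) \<le> 2 powi (- (- int c))"
      by (intro power_int_increasing) auto
    ultimately show ?thesis
      by (simp only: powi_minus_neg_int)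
  qed (simp add: assms(1))
  then have "pm_ext m ?A \<le> ennreal (2 ^ c)"
    unfolding pm_ext_def by (intro SUP_least ennreal_leI) auto
  then have "pm_ext m ?A < \<infinity>"
    by (rule le_less_trans) simp
  ultimately show ?thesis
    by (simp add: solovay_test_def)
qed

theorem mainTheorem2:
  fixes m :: "bstring set \<Rightarrow> real" and R :: "(bstring \<times> int) set set" and X :: cantor
  assumes "pre_measure m" and "dual_rule m R"
  shows "solovay_random m X \<longleftrightarrow> solovay_complex R X"
proof -
  obtain K where K: "optimal_complexity (dual_set m) K"
    and complex: "solovay_complex R X \<longleftrightarrow>
      filterlim (\<lambda>n. int (K (restr X n)) - int n) at_top sequentially"
    using solovay_complex_dual[OF assms(2)] by metis
  show ?thesis
    unfolding complex
  proof
    assume random: "solovay_random m X"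
    have "\<forall>\<^sub>F n in sequentially. Z \<le> int (K (restr X n)) - int n" for Z
    proof -
      \<comment> \<open>The offset must be a natural number; \<open>nat Z\<close> is at least
        \<open>Z\<close>, so leaving this test yields the bound \<open>Z\<close>.\<close>
      have "solovay_test m {\<sigma>. int (K \<sigma>) \<le> int (length \<sigma> + nat Z)}"
        using assms(1) K
        by (intro complexity_fn_dual_set_solovay_test)
          (simp_all add: pre_measure_def optimal_complexity_def)
      with random have "finite {n. int (K (restr X n)) \<le> int n + int (nat Z)}"
        by (fastforce simp: solovay_random_iff_finite)
      then have "\<forall>\<^sub>F n in sequentially. \<not> int (K (restr X n)) \<le> int n + int (nat Z)"
        by (simp add: eventually_cofinite flip: cofinite_eq_sequentially)
      then show ?thesis
        by (rule eventually_mono) linarith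
    qed
    then show "filterlim (\<lambda>n. int (K (restr X n)) - int n) at_top sequentially"
      by (simp add: filterlim_at_top)
  next
    assume lim: "filterlim (\<lambda>n. int (K (restr X n)) - int n) at_top sequentially"
    show "solovay_random m X"
      unfolding solovay_random_iff_finite
    proof (intro allI impI)
      fix A assume A: "solovay_test m A"
      then obtain c where c: "\<And>F. finite F \<Longrightarrow> F \<subseteq> A \<Longrightarrow> m F \<le> 2 ^ c"
        by (rule solovay_test_bounded) blast
      let ?B = "(\<lambda>\<sigma>. (\<sigma>, int (length \<sigma> + c))) ` A"
      have "re_pairs ?B"
        using A by (intro re_pairs_length_add) (simp add: solovay_test_def)
      moreover have "\<forall>r. finite r \<longrightarrow> r \<subseteq> ?B \<longrightarrow> r \<in> dual_set m"
        using solovay_test_imp_dual_set[of A m c, OF c] by blast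
      ultimately obtain e where e: "\<forall>(\<sigma>, d)\<in>?B. int (K \<sigma>) \<le> d + e"
        using K unfolding optimal_complexity_def by meson
      \<comment> \<open>Segments in \<open>A\<close> satisfy
        \<open>K (restr X n) - n \<le> c + e\<close>; the extra 1 excludes them.\<close>
      have "\<forall>\<^sub>F n in sequentially. int c + e + 1 \<le> int (K (restr X n)) - int n"
        using lim by (simp add: filterlim_at_top)
      then have "\<forall>\<^sub>F n in sequentially. restr X n \<notin> A"
      proof (rule eventually_mono)
        fix n assume "int c + e + 1 \<le> int (K (restr X n)) - int n"
        with e show "restr X n \<notin> A" by fastforce
      qed
      then show "finite {n. restr X n \<in> A}"
        by (simp add: eventually_cofinite flip: cofinite_eq_sequentially)
    qed
  qed
qed

end
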